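(* Let $R$ be a ring. (1) If $R$ is uniquely $\Delta$-clean, then $R$ is $\Delta$-quasipolar. (2) If $R$ is uniquely clean, then $R$ is $\Delta$-quasipolar.
   Context: All rings are associative and unital; $U(R)$ is the group of units of $R$. $\Delta(R)=\{r\in R \mid r+u\in U(R)\text{ for all }u\in U(R)\}$. For $a\in R$, $comm(a)=\{x\in R\mid ax=xa\}$ and $comm^2(a)=\{y\in R\mid xy=yx\text{ for all }x\in comm(a)\}$. An element $a\in R$ is $\Delta$-quasipolar if there exists $p^2=p\in comm^2(a)$ such that $a+p\in\Delta(R)$; $R$ is $\Delta$-quasipolar if every element of $R$ is $\Delta$-quasipolar. $R$ is uniquely clean if every element of $R$ can be written in exactly one way as $e+u$ with $e$ an idempotent of $R$ and $u\in U(R)$. $R$ is uniquely $\Delta$-clean if every element of $R$ can be written in exactly one way as $e+d$ with $e$ an idempotent of $R$ and $d\in\Delta(R)$. *)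

theory Defs
  imports "HOL-Algebra.Ring"
begin

definition ring_idempotents :: "('a, 'b) ring_scheme \<Rightarrow> 'a set" where
  "ring_idempotents R = {e \<in> carrier R. e \<otimes>\<^bsub>R\<^esub> e = e}"

definition ring_Delta :: "('a, 'b) ring_scheme \<Rightarrow> 'a set" where
  "ring_Delta R = {r \<in> carrier R. \<forall>u \<in> Units R. r \<oplus>\<^bsub>R\<^esub> u \<in> Units R}"

definition ring_comm :: "('a, 'b) ring_scheme \<Rightarrow> 'a \<Rightarrow> 'a set" where
  "ring_comm R a = {x \<in> carrier R. a \<otimes>\<^bsub>R\<^esub> x = x \<otimes>\<^bsub>R\<^esub> a}"

definition ring_comm2 :: "('a, 'b) ring_scheme \<Rightarrow> 'a \<Rightarrow> 'a set" where
  "ring_comm2 R a = {y \<in> carrier R. \<forall>x \<in> ring_comm R a. x \<otimes>\<^bsub>R\<^esub> y = y \<otimes>\<^bsub>R\<^esub> x}"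

definition Delta_quasipolar_elem :: "('a, 'b) ring_scheme \<Rightarrow> 'a \<Rightarrow> bool" where
  "Delta_quasipolar_elem R a \<longleftrightarrow>
     (\<exists>p \<in> ring_idempotents R. p \<in> ring_comm2 R a \<and> a \<oplus>\<^bsub>R\<^esub> p \<in> ring_Delta R)"

definition Delta_quasipolar :: "('a, 'b) ring_scheme \<Rightarrow> bool" where
  "Delta_quasipolar R \<longleftrightarrow> (\<forall>a \<in> carrier R. Delta_quasipolar_elem R a)"

(* Uniqueness in the next two definitions is uniqueness of the pair of summands. *)

definition uniquely_clean :: "('a, 'b) ring_scheme \<Rightarrow> bool" where
  "uniquely_clean R \<longleftrightarrow>
     (\<forall>a \<in> carrier R. \<exists>!eu. eu \<in> ring_idempotents R \<times> Units R \<and> a = fst eu \<oplus>\<^bsub>R\<^esub> snd eu)"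

definition uniquely_Delta_clean :: "('a, 'b) ring_scheme \<Rightarrow> bool" where
  "uniquely_Delta_clean R \<longleftrightarrow>
     (\<forall>a \<in> carrier R. \<exists>!ed. ed \<in> ring_idempotents R \<times> ring_Delta R \<and> a = fst ed \<oplus>\<^bsub>R\<^esub> snd ed)"

end

theory Submission
  imports Defs
begin

text \<open>
  In both cases idempotents are central: for an idempotent \<open>e\<close> and \<open>n = ex - exe\<close> or
  \<open>n = xe - exe\<close> one has \<open>n\<^sup>2 = 0\<close>, and \<open>e + n\<close> is again idempotent. If \<open>R\<close> is uniquely clean, compare
  \<open>e + (1 + n) = (e + n) + 1\<close>. If \<open>R\<close> is uniquely \<open>\<Delta>\<close>-clean, then every unit lies in \<open>1 + \<Delta>(R)\<close>,
  hence \<open>n \<in> \<Delta>(R)\<close>, and one compares \<open>e + n = (e + n) + 0\<close>.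

  A \<open>\<Delta>\<close>-clean decomposition \<open>-a = p + d\<close> gives \<open>a + p = -d \<in> \<Delta>(R)\<close>. A clean decomposition
  \<open>a = e + u\<close> gives \<open>a + (1 - e) = 1 + u\<close>, so it remains to see that \<open>1 + u + v\<close> is a unit for all
  units \<open>u, v\<close>. Write it as \<open>e + w\<close> with \<open>e\<close> idempotent and \<open>w\<close> a unit. Then \<open>eu + ev = ew\<close>, so in the
  corner \<open>eR\<close> a unit \<open>y\<close> has the two clean decompositions \<open>e + x = 0 + y\<close>, which forces \<open>e = 0\<close>.
\<close>

context ring
begin

section \<open>Square-zero elements, idempotents and \<open>ring_Delta\<close> in an arbitrary
  ring\<close>

lemma add_minus_cancel:
  assumes "x \<in> carrier R" "y \<in> carrier R"
  shows "x \<oplus> (y \<ominus> x) = y"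
  using assms a_lcomm[of x y "\<ominus> x"] by (simp add: minus_eq r_neg)

lemma add_square_zero_idempotent:
  assumes e: "e \<in> ring_idempotents R" and n: "n \<in> carrier R"
    and en: "e \<otimes> n = n \<and> n \<otimes> e = \<zero> \<or> e \<otimes> n = \<zero> \<and> n \<otimes> e = n"
  shows "n \<otimes> n = \<zero>" "e \<oplus> n \<in> ring_idempotents R"
proof -
  have eR: "e \<in> carrier R" "e \<otimes> e = e"
    using e by (auto simp: ring_idempotents_def)
  \<comment> \<open>Under either alternative of \<open>en\<close>, one bracketing of
    \<open>n e n\<close> is zero and the other is \<open>n n\<close>.\<close>
  have "n \<otimes> e \<otimes> n = n \<otimes> (e \<otimes> n)"
    using eR n by (simp add: m_assoc)
  then show nn: "n \<otimes> n = \<zero>"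
    using en n by auto
  have "(e \<oplus> n) \<otimes> (e \<oplus> n) = e \<oplus> (e \<otimes> n \<oplus> n \<otimes> e)"
    using eR n nn by (simp add: l_distr r_distr a_ac)
  then show "e \<oplus> n \<in> ring_idempotents R"
    using en eR n by (auto simp: ring_idempotents_def)
qed

lemma one_add_square_zero_Units:
  assumes n: "n \<in> carrier R" and nn: "n \<otimes> n = \<zero>"
  shows "\<one> \<oplus> n \<in> Units R"
proof -
  have "(\<one> \<oplus> n) \<otimes> (\<one> \<oplus> \<ominus> n) = \<one>" "(\<one> \<oplus> \<ominus> n) \<otimes> (\<one> \<oplus> n) = \<one>"
    using n nn by (simp_all add: l_distr r_distr l_minus r_minus a_assoc r_neg l_neg)
  with n show ?thesis
    by (auto simp: Units_def)
qed

text \<open>\<open>rigid\<close> is the common form in which both uniqueness hypotheses enter.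
  Applied to \<open>e x - e x e\<close> and \<open>x e - e x e\<close>, it gives
  \<open>e x = e x e = x e\<close>.\<close>

lemma idempotent_commutes:
  assumes rigid: "\<And>n. n \<in> carrier R \<Longrightarrow> n \<otimes> n = \<zero> \<Longrightarrow> e \<oplus> n \<in> ring_idempotents R \<Longrightarrow> n = \<zero>"
    and e: "e \<in> ring_idempotents R" and x: "x \<in> carrier R"
  shows "x \<otimes> e = e \<otimes> x"
proof -
  have eR: "e \<in> carrier R" and ee: "e \<otimes> e = e"
    using e by (auto simp: ring_idempotents_def)
  have eey: "e \<otimes> (e \<otimes> y) = e \<otimes> y" if "y \<in> carrier R" for y
    using eR ee that by (simp flip: m_assoc)
  note rules = l_distr r_distr l_minus r_minus m_assoc ee eey r_neg l_neg minus_eq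
  let ?n = "e \<otimes> x \<ominus> e \<otimes> x \<otimes> e" and ?m = "x \<otimes> e \<ominus> e \<otimes> x \<otimes> e"
  have "e \<otimes> ?n = ?n" "?n \<otimes> e = \<zero>" "e \<otimes> ?m = \<zero>" "?m \<otimes> e = ?m"
    using eR x by (simp_all add: rules)
  moreover have "?n \<in> carrier R" "?m \<in> carrier R"
    using eR x by simp_all
  ultimately have "?n = \<zero>" "?m = \<zero>"
    using add_square_zero_idempotent[OF e] rigid by blast+
  then have "e \<otimes> x = e \<otimes> x \<otimes> e" "x \<otimes> e = e \<otimes> x \<otimes> e"
    using eR x by (metis a_minus_def add.inv_solve_right l_zero m_closed zero_closed)+
  then show ?thesis
    by metis
qed

lemma one_minus_idempotent:
  assumes "e \<in> ring_idempotents R"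
  shows "\<one> \<ominus> e \<in> ring_idempotents R"
proof -
  have "e \<in> carrier R" "e \<otimes> e = e"
    using assms by (auto simp: ring_idempotents_def)
  then show ?thesis
    by (simp add: ring_idempotents_def minus_eq l_distr r_distr l_minus r_minus r_neg l_neg a_assoc)
qed

lemma uminus_Units:
  assumes "u \<in> Units R"
  shows "\<ominus> u \<in> Units R"
proof -
  have "\<ominus> \<one> \<otimes> u \<in> Units R"
    using assms Units_minus_one_closed by (rule Units_m_closed[rotated])
  then show ?thesis
    using assms by (simp add: l_minus Units_closed)
qed

text \<open>Units are closed under negation, and \<open>-d + u = -(d + (-u))\<close>.\<close>

lemma uminus_Delta:
  assumes "d \<in> ring_Delta R"
  shows "\<ominus> d \<in> ring_Delta R"
proof -
  have d: "d \<in> carrier R" and du: "\<And>u. u \<in> Units R \<Longrightarrow> d \<oplus> u \<in> Units R"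
    using assms by (auto simp: ring_Delta_def)
  have "\<ominus> d \<oplus> u \<in> Units R" if u: "u \<in> Units R" for u
  proof -
    have "\<ominus> (d \<oplus> \<ominus> u) \<in> Units R"
      using u du uminus_Units by blast
    then show ?thesis
      using u d by (simp add: minus_add Units_closed)
  qed
  with d show ?thesis
    by (simp add: ring_Delta_def)
qed

lemma zero_Delta: "\<zero> \<in> ring_Delta R"
  by (simp add: ring_Delta_def Units_closed)

lemma idempotent_Units_eq_one:
  assumes "e \<in> ring_idempotents R" "e \<in> Units R"
  shows "e = \<one>"
proof -
  have "e \<otimes> e = e \<otimes> \<one>"
    using assms by (simp add: ring_idempotents_def)
  then show ?thesis
    using assms by (metis Units_closed Units_l_cancel one_closed)
qed

text \<open>A central element lies in the double commutant of every \<open>a\<close>.\<close>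

lemma Delta_quasipolar_elemI:
  assumes "p \<in> ring_idempotents R" "\<And>x. x \<in> carrier R \<Longrightarrow> x \<otimes> p = p \<otimes> x" "a \<oplus> p \<in> ring_Delta R"
  shows "Delta_quasipolar_elem R a"
proof -
  have "p \<in> ring_comm2 R a"
    using assms(1,2) unfolding ring_comm2_def ring_comm_def ring_idempotents_def by blast
  with assms(1,3) show ?thesis
    unfolding Delta_quasipolar_elem_def by blast
qed

section \<open>Existence and uniqueness of decompositions\<close>

lemma uniquely_Delta_clean_obtain:
  assumes "uniquely_Delta_clean R" "a \<in> carrier R"
  obtains e d where "e \<in> ring_idempotents R" "d \<in> ring_Delta R" "a = e \<oplus> d"
proof -
  obtain ed where "ed \<in> ring_idempotents R \<times> ring_Delta R" "a = fst ed \<oplus> snd ed"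
    using assms unfolding uniquely_Delta_clean_def by blast
  then show ?thesis
    using that[of "fst ed" "snd ed"] by (simp add: mem_Times_iff)
qed

lemma uniquely_Delta_clean_unique:
  assumes "uniquely_Delta_clean R"
    and "e \<in> ring_idempotents R" "d \<in> ring_Delta R" "e' \<in> ring_idempotents R" "d' \<in> ring_Delta R"
    and "e \<oplus> d = e' \<oplus> d'"
  shows "e = e'" "d = d'"
proof -
  have "e \<oplus> d \<in> carrier R"
    using assms by (auto simp: ring_idempotents_def ring_Delta_def)
  then have "(e, d) = (e', d')"
    using assms unfolding uniquely_Delta_clean_def by (metis SigmaI fst_conv snd_conv)
  then show "e = e'" "d = d'" by auto
qed

lemma uniquely_clean_obtain:
  assumes "uniquely_clean R" "a \<in> carrier R"
  obtains e u where "e \<in> ring_idempotents R" "u \<in> Units R" "a = e \<oplus> u"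
proof -
  obtain eu where "eu \<in> ring_idempotents R \<times> Units R" "a = fst eu \<oplus> snd eu"
    using assms unfolding uniquely_clean_def by blast
  then show ?thesis
    using that[of "fst eu" "snd eu"] by (simp add: mem_Times_iff)
qed

lemma uniquely_clean_unique:
  assumes "uniquely_clean R"
    and "e \<in> ring_idempotents R" "u \<in> Units R" "e' \<in> ring_idempotents R" "u' \<in> Units R"
    and "e \<oplus> u = e' \<oplus> u'"
  shows "e = e'"
proof -
  have "e \<oplus> u \<in> carrier R"
    using assms by (auto simp: ring_idempotents_def)
  then have "(e, u) = (e', u')"
    using assms unfolding uniquely_clean_def by (metis SigmaI fst_conv snd_conv)
  then show ?thesis by auto
qed

section \<open>Centrality of idempotents\<close>

lemma uniquely_Delta_clean_commutes:
  assumes R: "uniquely_Delta_clean R" and e: "e \<in> ring_idempotents R" and x: "x \<in> carrier R"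
  shows "x \<otimes> e = e \<otimes> x"
proof (rule idempotent_commutes[OF _ e x])
  fix n
  assume n: "n \<in> carrier R" and nn: "n \<otimes> n = \<zero>" and en: "e \<oplus> n \<in> ring_idempotents R"
  have u: "\<one> \<oplus> n \<in> Units R"
    using n nn by (rule one_add_square_zero_Units)
  \<comment> \<open>The aim is that \<open>n\<close> lies in \<open>ring_Delta R\<close>. Since
    \<open>-d\<close> does too when \<open>d\<close> does, \<open>f = -d + (1 + n)\<close> is a
    unit; an idempotent unit is \<open>1\<close>, whence \<open>d = n\<close>.\<close>
  obtain f d where f: "f \<in> ring_idempotents R" and d: "d \<in> ring_Delta R" and fd: "\<one> \<oplus> n = f \<oplus> d"
    using uniquely_Delta_clean_obtain[OF R] u by blast
  have fdR: "f \<in> carrier R" "d \<in> carrier R"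
    using f d by (auto simp: ring_idempotents_def ring_Delta_def)
  have "\<ominus> d \<oplus> (\<one> \<oplus> n) \<in> Units R"
    using uminus_Delta[OF d] u by (simp add: ring_Delta_def)
  moreover have "\<ominus> d \<oplus> (\<one> \<oplus> n) = f"
    unfolding fd using fdR by (simp add: a_comm[of f] r_neg1)
  ultimately have "f = \<one>"
    using f idempotent_Units_eq_one by simp
  with fd n fdR d have nD: "n \<in> ring_Delta R"
    by simp
  have "e \<in> carrier R"
    using e by (simp add: ring_idempotents_def)
  then show "n = \<zero>"
    using uniquely_Delta_clean_unique(2)[OF R e nD en zero_Delta] n by simp
qed

lemma uniquely_clean_commutes:
  assumes R: "uniquely_clean R" and e: "e \<in> ring_idempotents R" and x: "x \<in> carrier R"
  shows "x \<otimes> e = e \<otimes> x"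
proof (rule idempotent_commutes[OF _ e x])
  fix n
  assume n: "n \<in> carrier R" and nn: "n \<otimes> n = \<zero>" and en: "e \<oplus> n \<in> ring_idempotents R"
  have eR: "e \<in> carrier R"
    using e by (simp add: ring_idempotents_def)
  have "e \<oplus> (\<one> \<oplus> n) = (e \<oplus> n) \<oplus> \<one>"
    using eR n by (simp add: a_ac)
  then have "e = e \<oplus> n"
    by (rule uniquely_clean_unique[OF R e one_add_square_zero_Units[OF n nn] en Units_one_closed])
  then show "n = \<zero>"
    using eR n by (metis add.l_cancel_one')
qed

section \<open>Corners, and why \<open>1 + u\<close> lies in \<open>ring_Delta R\<close>\<close>

lemma corner_Units_extend:
  assumes e: "e \<in> ring_idempotents R" and central: "\<And>x. x \<in> carrier R \<Longrightarrow> x \<otimes> e = e \<otimes> x"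
    and u: "u \<in> Units R"
  shows "e \<otimes> u \<oplus> (\<one> \<ominus> e) \<in> Units R"
proof -
  have eR: "e \<in> carrier R" and ee: "e \<otimes> e = e"
    using e by (auto simp: ring_idempotents_def)
  \<comment> \<open>As \<open>e\<close> is central, \<open>R\<close> splits into \<open>eR\<close>
    and \<open>(1 - e)R\<close>, and products are taken componentwise: \<open>s t = 1\<close> gives
    \<open>e\<close> in the first component and \<open>1 - e\<close> in the second. Exchanging
    \<open>s\<close> and \<open>t\<close> yields the two-sided inverse.\<close>
  have inverse: "(e \<otimes> s \<oplus> (\<one> \<ominus> e)) \<otimes> (e \<otimes> t \<oplus> (\<one> \<ominus> e)) = \<one>"
    if "s \<in> carrier R" "t \<in> carrier R" "s \<otimes> t = \<one>" for s t
  proof -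
    let ?f = "\<one> \<ominus> e"
    have f: "?f \<in> carrier R" "?f \<otimes> ?f = ?f"
      using one_minus_idempotent[OF e] by (auto simp: ring_idempotents_def)
    have ef: "e \<otimes> ?f = \<zero>" and fe: "?f \<otimes> e = \<zero>"
      using eR ee by (simp_all add: minus_eq l_distr r_distr l_minus r_minus r_neg)
    have est: "e \<otimes> s \<otimes> (e \<otimes> t) = e"
      using that eR ee central[of s] by (metis m_assoc m_closed r_one)
    have "e \<otimes> s \<otimes> ?f = \<zero>"
      using that eR f ef central[of s] by (metis m_assoc r_null)
    moreover have "?f \<otimes> (e \<otimes> t) = \<zero>"
      using that eR f fe by (metis m_assoc l_null)
    ultimately show ?thesis
      using that eR f est by (simp add: l_distr r_distr add_minus_cancel)
  qed
  have "inv u \<in> carrier R" "u \<in> carrier R" "u \<otimes> inv u = \<one>" "inv u \<otimes> u = \<one>"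
    using u by auto
  then show ?thesis
    using inverse[of u "inv u"] inverse[of "inv u" u] eR
    by (auto simp: Units_def intro!: bexI[of _ "e \<otimes> inv u \<oplus> (\<one> \<ominus> e)"])
qed

lemma uniquely_clean_one_add_Units_Delta:
  assumes R: "uniquely_clean R" and u: "u \<in> Units R"
  shows "\<one> \<oplus> u \<in> ring_Delta R"
proof -
  have "\<one> \<oplus> u \<oplus> v \<in> Units R" if v: "v \<in> Units R" for v
  proof -
    have uv: "u \<in> carrier R" "v \<in> carrier R"
      using u v by auto
    obtain e w where e: "e \<in> ring_idempotents R" and w: "w \<in> Units R"
      and ew: "\<one> \<oplus> u \<oplus> v = e \<oplus> w"
      using uniquely_clean_obtain[OF R, of "\<one> \<oplus> u \<oplus> v"] uv by auto
    have eR: "e \<in> carrier R" and ee: "e \<otimes> e = e" and wR: "w \<in> carrier R"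
      using e w by (auto simp: ring_idempotents_def)
    \<comment> \<open>After multiplication by \<open>e\<close>, the summand \<open>1\<close> on the
      left and the summand \<open>e\<close> on the right both become \<open>e\<close> and
      cancel.\<close>
    have "e \<otimes> (\<one> \<oplus> u \<oplus> v) = e \<otimes> (e \<oplus> w)"
      by (simp add: ew)
    then have "e \<oplus> (e \<otimes> u \<oplus> e \<otimes> v) = e \<oplus> e \<otimes> w"
      using eR ee uv wR by (simp add: r_distr a_assoc)
    then have euv: "e \<otimes> u \<oplus> e \<otimes> v = e \<otimes> w"
      using eR uv wR by (metis a_closed m_closed r_neg1)
    \<comment> \<open>Division by \<open>v\<close> turns \<open>e v\<close> into \<open>e\<close>,
      the identity of the corner, so that \<open>exy\<close> exhibits \<open>e y\<close> as the
      idempotent \<open>e\<close> plus the corner unit \<open>e x\<close>.\<close>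
    define x where "x = u \<otimes> inv v"
    define y where "y = w \<otimes> inv v"
    have x: "x \<in> Units R" and y: "y \<in> Units R"
      unfolding x_def y_def using u v w by auto
    have xy: "x \<in> carrier R" "y \<in> carrier R"
      using x y by auto
    have "(e \<otimes> u \<oplus> e \<otimes> v) \<otimes> inv v = e \<otimes> w \<otimes> inv v"
      by (simp add: euv)
    then have exy: "e \<otimes> x \<oplus> e = e \<otimes> y"
      using eR uv wR v by (simp add: l_distr m_assoc x_def y_def)
    \<comment> \<open>Adding \<open>1 - e\<close> to both sides of \<open>exy\<close> lifts the two
      corner decompositions to clean decompositions in \<open>R\<close>, where uniqueness
      applies.\<close>
    have "e \<oplus> (e \<otimes> x \<oplus> (\<one> \<ominus> e)) = \<zero> \<oplus> (e \<otimes> y \<oplus> (\<one> \<ominus> e))"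
      using eR xy by (simp add: a_ac flip: exy)
    moreover have "\<zero> \<in> ring_idempotents R"
      by (simp add: ring_idempotents_def)
    ultimately have "e = \<zero>"
      using uniquely_clean_unique[OF R e] corner_Units_extend[OF e uniquely_clean_commutes[OF R e]] x y
      by blast
    then show ?thesis
      using ew w wR by simp
  qed
  then show ?thesis
    using u by (auto simp: ring_Delta_def)
qed

section \<open>The two implications\<close>

lemma uniquely_Delta_clean_imp_Delta_quasipolar:
  assumes R: "uniquely_Delta_clean R"
  shows "Delta_quasipolar R"
  unfolding Delta_quasipolar_def
proof
  fix a
  assume a: "a \<in> carrier R"
  \<comment> \<open>Decomposing \<open>-a\<close> instead of \<open>a\<close> gives \<open>p\<close>
    the sign that \<open>a + p\<close> requires.\<close>
  then obtain p d where p: "p \<in> ring_idempotents R" and d: "d \<in> ring_Delta R" and pd: "\<ominus> a = p \<oplus> d"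
    using uniquely_Delta_clean_obtain[OF R, of "\<ominus> a"] by auto
  have pdR: "p \<in> carrier R" "d \<in> carrier R"
    using p d by (auto simp: ring_idempotents_def ring_Delta_def)
  have "a = \<ominus> (p \<oplus> d)"
    using a by (simp flip: pd)
  then have "a \<oplus> p = \<ominus> d"
    using pdR add_minus_cancel[of p "\<ominus> d"] by (simp add: minus_add minus_eq a_comm)
  then show "Delta_quasipolar_elem R a"
    using Delta_quasipolar_elemI[OF p uniquely_Delta_clean_commutes[OF R p]] uminus_Delta[OF d]
    by simp
qed

lemma uniquely_clean_imp_Delta_quasipolar:
  assumes R: "uniquely_clean R"
  shows "Delta_quasipolar R"
  unfolding Delta_quasipolar_def
proof
  fix a
  assume a: "a \<in> carrier R"
  then obtain e u where e: "e \<in> ring_idempotents R" and u: "u \<in> Units R" and eu: "a = e \<oplus> u"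
    using uniquely_clean_obtain[OF R] by blast
  have "e \<in> carrier R" "u \<in> carrier R"
    using e u by (auto simp: ring_idempotents_def)
  \<comment> \<open>The witness is the complementary idempotent, which completes \<open>e\<close> to
    \<open>1\<close>.\<close>
  then have "a \<oplus> (\<one> \<ominus> e) = u \<oplus> (e \<oplus> (\<one> \<ominus> e))"
    by (simp add: eu a_ac)
  also have "\<dots> = \<one> \<oplus> u"
    using \<open>e \<in> carrier R\<close> \<open>u \<in> carrier R\<close> by (simp add: add_minus_cancel a_comm)
  finally have "a \<oplus> (\<one> \<ominus> e) = \<one> \<oplus> u" .
  then show "Delta_quasipolar_elem R a"
    using Delta_quasipolar_elemI[OF one_minus_idempotent[OF e]]
      uniquely_clean_commutes[OF R one_minus_idempotent[OF e]]
      uniquely_clean_one_add_Units_Delta[OF R u]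
    by simp
qed

end

theorem corollary2p9:
  fixes R :: "('a, 'b) ring_scheme"
  assumes "ring R"
  shows "(uniquely_Delta_clean R \<longrightarrow> Delta_quasipolar R) \<and>
         (uniquely_clean R \<longrightarrow> Delta_quasipolar R)"
  using ring.uniquely_Delta_clean_imp_Delta_quasipolar[OF assms]
    ring.uniquely_clean_imp_Delta_quasipolar[OF assms] by blast

end
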